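(* Let $Z\in\mathbb{R}^{p\times n}$, $D\in\mathbb{R}^{p\times m}$, $\lambda_1,\lambda_2\ge0$, and let $h(X)=\frac12\|Z-DX\|_F^2+\frac{\lambda_2}{2}\|X\|_F^2$ for $X\in\mathbb{R}^{m\times n}$, where $h$ is assumed strongly convex. Suppose that $(Y^*,X^* )$ is a local minimizer of $$\min_{Y,X\in\mathbb{R}^{m\times n}}\ h(X)+\lambda_1\|Y\|_0\quad\text{s.t. } Y=X.$$ Then there exists $U^*\in\mathbb{R}^{m\times n}$ such that $(Y^*,X^*,U^* )$ is a KKT point of this problem. Furthermore, there exists $\epsilon_*>0$ such that $(Y^*,X^*,U^* )$ is a P-stationary point (with parameter $\alpha$) for every $\alpha$ with $0<\alpha<\alpha_*:=\min\{\alpha_1^*,\alpha_2^*\}$, where $$\alpha_1^*:=\frac{\epsilon_*}{2\lambda_1\|Y^*\|_0+2\sqrt{\lambda_1^2\|Y^*\|_0^2+\epsilon_*\|\nabla h(X^* )\|_F^2}},\qquad \alpha_2^*:=\frac{1}{\sqrt n\,\|D^\top D+\lambda_2 I\|_F},$$ with the convention $\alpha_1^*=+\infty$ if its denominator is zero.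
   Context: $\|\cdot\|_F$ is the Frobenius norm; $\|Y\|_0$ is the number of nonzero entries of $Y$. $\nabla h(X)=(D^\top D+\lambda_2 I)X-D^\top Z$. KKT point: $(Y^*,X^*,U^* )$ is a KKT point if $0\in\lambda_1\,\partial\|Y^*\|_0-U^*$, $0=\nabla h(X^* )+U^*$ and $Y^*=X^*$, where $\partial\|Y\|_0=\{V\in\mathbb{R}^{m\times n}: V_{ij}=0\ \text{for all }(i,j)\text{ with }Y_{ij}\ne0\}$. P-stationary point: for $\alpha>0$, $(Y^*,X^*,U^* )$ is a P-stationary point with parameter $\alpha$ if $Y^*=\operatorname{Prox}_{\alpha\lambda_1\|\cdot\|_0}(Y^*+\alpha U^* )$, $0=\nabla h(X^* )+U^*$ and $Y^*=X^*$. Here the (in general multi-valued) proximal operator is taken as the entrywise hard-thresholding map $$\left[\operatorname{Prox}_{\alpha\lambda_1\|\cdot\|_0}(A)\right]_{ij}=\begin{cases} 0, & \frac12 A_{ij}^2\le\alpha\lambda_1, \\ A_{ij}, & \frac12 A_{ij}^2>\alpha\lambda_1. \end{cases}$$ *)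

theory Defs
  imports "HOL-Analysis.Analysis"
begin

text \<open>
  A real \<open>m \<times> n\<close> matrix has type \<^typ>\<open>real^'n^'m\<close>. On this type the library norm
  and inner product are the Frobenius ones.
\<close>

lemma norm_matrix_eq_frobenius:
  fixes A :: "real^'n^'m"
  shows "norm A = sqrt (\<Sum>i\<in>UNIV. \<Sum>j\<in>UNIV. (A $ i $ j)\<^sup>2)"
  by (simp add: norm_vec_def L2_set_def sum_nonneg)

definition l0_norm :: "real^'n^'m \<Rightarrow> nat" where
  "l0_norm Y = card {(i, j). Y $ i $ j \<noteq> 0}"

definition l0_subdiff :: "real^'n^'m \<Rightarrow> (real^'n^'m) set" where
  "l0_subdiff Y = {V. \<forall>i j. Y $ i $ j \<noteq> 0 \<longrightarrow> V $ i $ j = 0}"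

text \<open>
  The selection of \<open>Prox\<^bsub>\<tau>\<parallel>\<cdot>\<parallel>\<^sub>0\<^esub>\<close> that takes the value \<open>0\<close> at the threshold
  \<open>1/2 A\<^sub>i\<^sub>j\<^sup>2 = \<tau>\<close>, where the proximal operator is multi-valued.
\<close>

definition prox_l0 :: "real \<Rightarrow> real^'n^'m \<Rightarrow> real^'n^'m" where
  "prox_l0 \<tau> A = (\<chi> i j. if (1/2) * (A $ i $ j)\<^sup>2 \<le> \<tau> then 0 else A $ i $ j)"

definition gradient :: "('a::real_inner \<Rightarrow> real) \<Rightarrow> 'a \<Rightarrow> 'a" where
  "gradient f x = (THE g. GDERIV f x :> g)"

definition strongly_convex :: "('a::real_normed_vector \<Rightarrow> real) \<Rightarrow> bool" where
  "strongly_convex f \<longleftrightarrow>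
     (\<exists>\<mu>>0. \<forall>x y t. 0 \<le> t \<longrightarrow> t \<le> 1 \<longrightarrow>
        f (t *\<^sub>R x + (1 - t) *\<^sub>R y)
          \<le> t * f x + (1 - t) * f y - \<mu> / 2 * t * (1 - t) * (norm (x - y))\<^sup>2)"

definition local_minimizer_on :: "('a::metric_space \<Rightarrow> real) \<Rightarrow> 'a set \<Rightarrow> 'a \<Rightarrow> bool" where
  "local_minimizer_on f S x \<longleftrightarrow> x \<in> S \<and> (\<exists>\<delta>>0. \<forall>z \<in> S \<inter> ball x \<delta>. f x \<le> f z)"

definition smooth_part ::
    "real^'n^'p \<Rightarrow> real^'m^'p \<Rightarrow> real \<Rightarrow> real^'n^'m \<Rightarrow> real" where
  "smooth_part Z D lam2 X = (1/2) * (norm (Z - D ** X))\<^sup>2 + (lam2 / 2) * (norm X)\<^sup>2"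

definition gram :: "real^'m^'p \<Rightarrow> real \<Rightarrow> real^'m^'m" where
  "gram D lam2 = transpose D ** D + lam2 *\<^sub>R mat 1"

lemma gradient_eqI:
  assumes "GDERIV f x :> g"
  shows "gradient f x = g"
  unfolding gradient_def
proof (rule the_equality)
  show "GDERIV f x :> g" by (rule assms)
next
  fix g' assume "GDERIV f x :> g'"
  with assms have "(\<lambda>v. inner v g') = (\<lambda>v. inner v g)"
    unfolding gderiv_def by (blast intro: has_derivative_unique)
  then have "inner (g' - g) g' = inner (g' - g) g" by metis
  then have "inner (g' - g) (g' - g) = 0" by (simp add: inner_diff_right)
  then show "g' = g" by simp
qed

lemma inner_matrix_mult_left:
  fixes D :: "real^'m^'p" and V :: "real^'n^'m" and W :: "real^'n^'p"
  shows "inner (D ** V) W = inner V (transpose D ** W)"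
proof -
  have "inner (D ** V) W
      = (\<Sum>i\<in>UNIV. \<Sum>j\<in>UNIV. \<Sum>k\<in>UNIV. D $ i $ k * V $ k $ j * W $ i $ j)"
    by (simp add: inner_vec_def matrix_matrix_mult_def sum_distrib_right)
  also have "\<dots> = (\<Sum>i\<in>UNIV. \<Sum>k\<in>UNIV. \<Sum>j\<in>UNIV. D $ i $ k * V $ k $ j * W $ i $ j)"
    by (intro sum.cong refl) (rule sum.swap)
  also have "\<dots> = (\<Sum>k\<in>UNIV. \<Sum>i\<in>UNIV. \<Sum>j\<in>UNIV. D $ i $ k * V $ k $ j * W $ i $ j)"
    by (rule sum.swap)
  also have "\<dots> = (\<Sum>k\<in>UNIV. \<Sum>j\<in>UNIV. \<Sum>i\<in>UNIV. D $ i $ k * V $ k $ j * W $ i $ j)"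
    by (intro sum.cong refl) (rule sum.swap)
  also have "\<dots> = inner V (transpose D ** W)"
    by (simp add: inner_vec_def matrix_matrix_mult_def transpose_def sum_distrib_left ac_simps)
  finally show ?thesis .
qed

lemma bounded_linear_matrix_mult_left:
  fixes D :: "real^'m^'p"
  shows "bounded_linear (\<lambda>X::real^'n^'m. D ** X)"
  unfolding linear_conv_bounded_linear[symmetric]
  by (rule linearI)
     (simp_all add: matrix_matrix_mult_def vec_eq_iff distrib_left sum.distrib sum_distrib_left ac_simps)

lemma GDERIV_smooth_part:
  fixes Z :: "real^'n^'p" and D :: "real^'m^'p" and X :: "real^'n^'m"
  shows "GDERIV (smooth_part Z D lam2) X :> gram D lam2 ** X - transpose D ** Z"
proof -
  have D: "((\<lambda>X::real^'n^'m. D ** X) has_derivative (\<lambda>V. D ** V)) (at X)"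
    by (rule bounded_linear_imp_has_derivative[OF bounded_linear_matrix_mult_left])
  have eq: "smooth_part Z D lam2 = (\<lambda>X. (1/2) * inner (Z - D ** X) (Z - D ** X) + (lam2 / 2) * inner X X)"
    by (simp add: fun_eq_iff smooth_part_def power2_norm_eq_inner)
  have lam: "(lam2 *\<^sub>R mat 1 :: real^'m^'m) ** X = lam2 *\<^sub>R X"
    by (simp add: matrix_matrix_mult_def mat_def vec_eq_iff if_distrib[of "\<lambda>x. _ * x"]
          if_distrib[of "\<lambda>x. x * _"] cong: if_cong)
  have add: "(A + B) ** X = A ** X + B ** X" for A B :: "real^'m^'m"
    by (simp add: matrix_matrix_mult_def vec_eq_iff distrib_right sum.distrib)
  have gX: "gram D lam2 ** X - transpose D ** Z = transpose D ** (D ** X) - transpose D ** Z + lam2 *\<^sub>R X"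
    by (simp add: gram_def add lam matrix_mul_assoc)
  show ?thesis
    unfolding gderiv_def eq gX
    apply (rule derivative_eq_intros D refl)+
    apply (simp add: fun_eq_iff inner_diff_right inner_add_right inner_diff_left
        inner_matrix_mult_left[symmetric] inner_commute algebra_simps)
    done
qed

lemma gradient_smooth_part:
  "gradient (smooth_part Z D lam2) X = gram D lam2 ** X - transpose D ** Z"
  by (rule gradient_eqI[OF GDERIV_smooth_part])

text \<open>
  In the following, \<open>h\<close> is the smooth part of the objective and \<open>lam1\<close> the weight
  of the \<open>\<ell>\<^sub>0\<close> term.
\<close>

definition KKT_point ::
    "(real^'n^'m \<Rightarrow> real) \<Rightarrow> real \<Rightarrow> real^'n^'m \<Rightarrow> real^'n^'m \<Rightarrow> real^'n^'m \<Rightarrow> bool" where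
  "KKT_point h lam1 Y X U \<longleftrightarrow>
     0 \<in> (\<lambda>V. lam1 *\<^sub>R V - U) ` l0_subdiff Y \<and> 0 = gradient h X + U \<and> Y = X"

definition P_stationary_point ::
    "(real^'n^'m \<Rightarrow> real) \<Rightarrow> real \<Rightarrow> real \<Rightarrow> real^'n^'m \<Rightarrow> real^'n^'m \<Rightarrow> real^'n^'m \<Rightarrow> bool" where
  "P_stationary_point h lam1 \<alpha> Y X U \<longleftrightarrow>
     Y = prox_l0 (\<alpha> * lam1) (Y + \<alpha> *\<^sub>R U) \<and> 0 = gradient h X + U \<and> Y = X"

definition alpha1 ::
    "(real^'n^'m \<Rightarrow> real) \<Rightarrow> real \<Rightarrow> real \<Rightarrow> real^'n^'m \<Rightarrow> real^'n^'m \<Rightarrow> ereal" where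
  "alpha1 h lam1 \<epsilon> Y X =
     (let d = 2 * lam1 * real (l0_norm Y)
            + 2 * sqrt (lam1\<^sup>2 * (real (l0_norm Y))\<^sup>2 + \<epsilon> * (norm (gradient h X))\<^sup>2)
      in if d = 0 then \<infinity> else ereal (\<epsilon> / d))"

text \<open>
  The number \<open>n\<close> of columns does not occur in the type of \<open>D\<close>, hence the explicit
  argument. If \<^term>\<open>smooth_part Z D lam2\<close> is strongly convex then \<^term>\<open>gram D lam2\<close> is
  nonzero, so the denominator does not vanish.
\<close>

definition alpha2 :: "nat \<Rightarrow> real^'m^'p \<Rightarrow> real \<Rightarrow> real" where
  "alpha2 n D lam2 = 1 / (sqrt (real n) * norm (gram D lam2))"

end

theory Submission
  imports Defs
begin

text \<open>
  Take \<open>U = - \<nabla>h(X)\<close>. Perturbing a single nonzero entry of the minimizer slightly does not change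
  \<open>\<parallel>\<cdot>\<parallel>\<^sub>0\<close>, so the partial derivative of \<open>h\<close> in that entry vanishes; this is the KKT condition. For
  \<open>lam1 > 0\<close> P-stationarity then amounts to finitely many strict inequalities that hold at \<open>\<alpha> = 0\<close>,
  so it holds on some interval \<open>0 < \<alpha> < \<alpha>\<^sub>0\<close>. Finally \<open>\<alpha>\<^sub>1\<^sup>*\<close> tends to \<open>0\<close> with \<open>\<epsilon>\<^sub>*\<close>, unless its
  denominator is zero, so \<open>\<epsilon>\<^sub>*\<close> can be chosen with \<open>\<alpha>\<^sub>1\<^sup>* \<le> \<alpha>\<^sub>0\<close>. If that denominator
  is zero or \<open>lam1 = 0\<close>, then P-stationarity holds for every \<open>\<alpha> > 0\<close>.
\<close>

lemma l0_norm_eq_0_iff: "l0_norm Y = 0 \<longleftrightarrow> Y = (0 :: real^'n^'m)"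
  by (auto simp: l0_norm_def card_eq_0_iff vec_eq_iff)

text \<open>Only the entry (i, j) is touched, and it is nonzero before and after, so both matrices
  have the same support.\<close>

lemma l0_norm_add_axis:
  fixes Y :: "real^'n^'m"
  assumes "Y $ i $ j \<noteq> 0" "Y $ i $ j + t \<noteq> 0"
  shows "l0_norm (Y + t *\<^sub>R axis i (axis j 1)) = l0_norm Y"
proof -
  have "(Y + t *\<^sub>R axis i (axis j 1)) $ a $ b = Y $ a $ b + (if a = i \<and> b = j then t else 0)" for a b
    by (simp add: axis_def)
  with assms show ?thesis
    unfolding l0_norm_def by (intro arg_cong[where f = card]) (auto split: if_splits)
qed

text \<open>The diagonal map sending x to (x, x) is continuous, so a ball around (X, X) pulls back
  to a neighbourhood of X. This makes the constrained problem an unconstrained one for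
  \<open>h + g\<close>.\<close>

lemma local_minimizer_on_diagonal:
  fixes h :: "'a::metric_space \<Rightarrow> real"
  assumes "local_minimizer_on (\<lambda>(y, x). h x + g y) {(y, x). y = x} (Y, X)"
  shows "Y = X" and "\<forall>\<^sub>F x in nhds X. h X + g X \<le> h x + g x"
proof -
  show YX: "Y = X"
    using assms by (auto simp: local_minimizer_on_def)
  obtain \<delta> where "\<delta> > 0"
    and \<delta>: "\<forall>z\<in>{(y, x). y = x} \<inter> ball (X, X) \<delta>. h X + g X \<le> (case z of (y, x) \<Rightarrow> h x + g y)"
    using assms YX by (auto simp: local_minimizer_on_def)
  have "((\<lambda>x. (x, x)) \<longlongrightarrow> (X, X)) (nhds X)"
    by (intro tendsto_Pair filterlim_ident)
  then have "\<forall>\<^sub>F x in nhds X. (x, x) \<in> ball (X, X) \<delta>"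
    by (rule topological_tendstoD) (use \<open>\<delta> > 0\<close> in auto)
  then show "\<forall>\<^sub>F x in nhds X. h X + g X \<le> h x + g x"
    by eventually_elim (drule bspec[OF \<delta>, OF IntI, rotated], simp_all)
qed

lemma GDERIV_directional:
  assumes "GDERIV f x :> g"
  shows "((\<lambda>t. f (x + t *\<^sub>R v)) has_real_derivative inner v g) (at 0)"
proof -
  have "((\<lambda>t::real. x + t *\<^sub>R v) has_derivative (\<lambda>t. t *\<^sub>R v)) (at 0)"
    by (auto intro!: derivative_eq_intros)
  moreover have "(f has_derivative (\<lambda>w. inner w g)) (at (x + 0 *\<^sub>R v))"
    using assms by (simp add: gderiv_def)
  ultimately have "((\<lambda>t. f (x + t *\<^sub>R v)) has_derivative (\<lambda>t. inner (t *\<^sub>R v) g)) (at 0)"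
    by (rule has_derivative_compose)
  then show ?thesis
    by (simp add: has_field_derivative_def mult_commute_abs)
qed

lemma gradient_entry_eq_0:
  fixes X G :: "real^'n^'m"
  assumes der: "GDERIV h X :> G"
    and min: "\<forall>\<^sub>F W in nhds X. h X + lam1 * real (l0_norm X) \<le> h W + lam1 * real (l0_norm W)"
    and entry: "lam1 = 0 \<or> X $ i $ j \<noteq> 0"
  shows "G $ i $ j = 0"
proof -
  define E :: "real^'n^'m" where "E = axis i (axis j 1)"
  have "((\<lambda>t::real. X + t *\<^sub>R E) \<longlongrightarrow> X + 0 *\<^sub>R E) (nhds 0)"
    by (intro tendsto_intros filterlim_ident)
  then have "filterlim (\<lambda>t::real. X + t *\<^sub>R E) (nhds X) (nhds 0)"
    by simp
  with min have ev_min: "\<forall>\<^sub>F t in nhds 0. h X + lam1 * real (l0_norm X)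
      \<le> h (X + t *\<^sub>R E) + lam1 * real (l0_norm (X + t *\<^sub>R E))"
    by (rule eventually_compose_filterlim)
  \<comment> \<open>Once the weighted count is locally constant along the line, it cancels, and t =
    0 is a local minimum of \<open>h\<close> alone in direction \<open>E\<close>.\<close>
  have ev_l0: "\<forall>\<^sub>F t in nhds 0. lam1 * real (l0_norm (X + t *\<^sub>R E)) = lam1 * real (l0_norm X)"
  proof (cases "lam1 = 0")
    case False
    then have nz: "X $ i $ j \<noteq> 0"
      using entry by simp
    have "((\<lambda>t. X $ i $ j + t) \<longlongrightarrow> X $ i $ j + 0) (nhds 0)"
      by (intro tendsto_intros filterlim_ident)
    then have "\<forall>\<^sub>F t in nhds 0. X $ i $ j + t \<noteq> 0"
      by (rule tendsto_imp_eventually_ne) (use nz in simp)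
    then show ?thesis
      by eventually_elim (use nz in \<open>simp add: E_def l0_norm_add_axis\<close>)
  qed simp
  from ev_min ev_l0 have "\<forall>\<^sub>F t in nhds 0. h X \<le> h (X + t *\<^sub>R E)"
    by eventually_elim simp
  then obtain \<delta> where "\<delta> > 0" and \<delta>: "\<And>t. \<bar>t\<bar> < \<delta> \<Longrightarrow> h X \<le> h (X + t *\<^sub>R E)"
    by (auto simp: eventually_nhds_metric dist_real_def)
  then have "inner E G = 0"
    by (intro DERIV_local_min[OF GDERIV_directional[OF der] \<open>\<delta> > 0\<close>]) auto
  then show ?thesis
    by (simp add: E_def inner_axis')
qed

text \<open>Where Y vanishes, the threshold test reads \<alpha> U_ij^2 \<le> 2 lam1 after division
  by \<alpha>/2; elsewhere U vanishes and the test is \<alpha> lam1 < Y_ij^2 / 2. Each holds for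
  small \<alpha>, and there are finitely many entries.\<close>

lemma eventually_prox_l0_fixed:
  fixes Y U :: "real^'n^'m"
  assumes "lam1 > 0" and compl: "\<And>i j. Y $ i $ j \<noteq> 0 \<Longrightarrow> U $ i $ j = 0"
  shows "\<forall>\<^sub>F \<alpha> in at_right 0. Y = prox_l0 (\<alpha> * lam1) (Y + \<alpha> *\<^sub>R U)"
proof -
  have "\<forall>\<^sub>F \<alpha> in at_right 0. Y $ i $ j = prox_l0 (\<alpha> * lam1) (Y + \<alpha> *\<^sub>R U) $ i $ j" for i j
  proof (cases "Y $ i $ j = 0")
    case True
    have "((\<lambda>\<alpha>. \<alpha> * (U $ i $ j)\<^sup>2) \<longlongrightarrow> 0 * (U $ i $ j)\<^sup>2) (at_right 0)"
      by (intro tendsto_intros)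
    then have "\<forall>\<^sub>F \<alpha> in at_right 0. \<alpha> * (U $ i $ j)\<^sup>2 < 2 * lam1"
      by (rule order_tendstoD) (use \<open>lam1 > 0\<close> in simp)
    with eventually_at_right_less[of 0] show ?thesis
    proof eventually_elim
      case (elim \<alpha>)
      then have "\<alpha> * (\<alpha> * (U $ i $ j)\<^sup>2) \<le> \<alpha> * (2 * lam1)"
        by (intro mult_left_mono) auto
      then show ?case
        using True by (simp add: prox_l0_def power2_eq_square algebra_simps)
    qed
  next
    case False
    have "((\<lambda>\<alpha>. \<alpha> * lam1) \<longlongrightarrow> 0 * lam1) (at_right 0)"
      by (intro tendsto_intros)
    then have "\<forall>\<^sub>F \<alpha> in at_right 0. \<alpha> * lam1 < (1/2) * (Y $ i $ j)\<^sup>2"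
      by (rule order_tendstoD) (use False in simp)
    then show ?thesis
      by eventually_elim (use compl[OF False] in \<open>simp add: prox_l0_def\<close>)
  qed
  then have "\<forall>\<^sub>F \<alpha> in at_right 0. \<forall>i j. Y $ i $ j = prox_l0 (\<alpha> * lam1) (Y + \<alpha> *\<^sub>R U) $ i $ j"
    by (intro eventually_all_finite)
  then show ?thesis
    by (simp add: vec_eq_iff)
qed

lemma prox_l0_fixed_zero_threshold: "prox_l0 0 Y = Y"
  by (simp add: prox_l0_def vec_eq_iff)

lemma prox_l0_zero: "\<tau> \<ge> 0 \<Longrightarrow> prox_l0 \<tau> 0 = 0"
  by (simp add: prox_l0_def vec_eq_iff)

text \<open>With denominator d, the bound amounts to \<epsilon> \<le>
  \<open>\<alpha>\<^sub>0 * d \<epsilon>\<close>. If Y is nonzero, d stays above a positive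
  constant; if Y = 0, d is a positive multiple of the square root of \<epsilon>, which dominates
  \<epsilon> near 0.\<close>

lemma alpha1_le_small:
  fixes Y X :: "real^'n^'m"
  assumes "lam1 > 0" "\<alpha>\<^sub>0 > 0" and nz: "Y \<noteq> 0 \<or> gradient h X \<noteq> 0"
  shows "\<exists>\<epsilon>>0. alpha1 h lam1 \<epsilon> Y X \<le> ereal \<alpha>\<^sub>0"
proof -
  define k where "k = real (l0_norm Y)"
  define G where "G = gradient h X"
  define d where "d \<epsilon> = 2 * lam1 * k + 2 * sqrt (lam1\<^sup>2 * k\<^sup>2 + \<epsilon> * (norm G)\<^sup>2)" for \<epsilon>
  have "\<exists>\<epsilon>>0. d \<epsilon> > 0 \<and> \<epsilon> \<le> \<alpha>\<^sub>0 * d \<epsilon>"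
  proof (cases "Y = 0")
    case False
    then have "lam1 * k > 0"
      using \<open>lam1 > 0\<close> by (simp add: k_def l0_norm_eq_0_iff neq0_conv[symmetric] del: neq0_conv)
    have d: "d \<epsilon> \<ge> 2 * lam1 * k" if "\<epsilon> \<ge> 0" for \<epsilon>
      using that by (simp add: d_def)
    show ?thesis
    proof (intro exI conjI)
      \<comment> \<open>The witness is \<open>\<alpha>\<^sub>0\<close> times the lower bound of
        \<open>d\<close>.\<close>
      show pos: "\<alpha>\<^sub>0 * (2 * lam1 * k) > 0"
        using \<open>\<alpha>\<^sub>0 > 0\<close> \<open>lam1 * k > 0\<close> by (simp only: mult.assoc) simp
      show "d (\<alpha>\<^sub>0 * (2 * lam1 * k)) > 0"
        using d[OF less_imp_le[OF pos]] \<open>lam1 * k > 0\<close> by simp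
      show "\<alpha>\<^sub>0 * (2 * lam1 * k) \<le> \<alpha>\<^sub>0 * d (\<alpha>\<^sub>0 * (2 * lam1 * k))"
        using d[OF less_imp_le[OF pos]] \<open>\<alpha>\<^sub>0 > 0\<close> by (intro mult_left_mono) auto
    qed
  next
    case True
    then have G: "norm G > 0" and k: "k = 0"
      using nz by (simp_all add: G_def k_def l0_norm_eq_0_iff)
    \<comment> \<open>Solves \<open>s\<^sup>2 = \<alpha>\<^sub>0 * d (s\<^sup>2)\<close>, since
      \<open>d (s\<^sup>2)\<close> is linear in \<open>s\<close> when \<open>k = 0\<close>.\<close>
    define s where "s = 2 * \<alpha>\<^sub>0 * norm G"
    have "s > 0"
      using \<open>\<alpha>\<^sub>0 > 0\<close> G by (simp add: s_def)
    then have d: "d (s\<^sup>2) = 2 * (s * norm G)"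
      by (simp add: d_def k real_sqrt_mult)
    moreover have "s * norm G > 0"
      using \<open>s > 0\<close> G by simp
    ultimately have "d (s\<^sup>2) > 0"
      by simp
    moreover have "s\<^sup>2 \<le> \<alpha>\<^sub>0 * d (s\<^sup>2)"
      unfolding d by (simp add: s_def power2_eq_square)
    ultimately show ?thesis
      using \<open>s > 0\<close> by (intro exI[of _ "s\<^sup>2"]) simp
  qed
  then obtain \<epsilon> where "\<epsilon> > 0" "d \<epsilon> > 0" "\<epsilon> \<le> \<alpha>\<^sub>0 * d \<epsilon>"
    by blast
  moreover from this have "alpha1 h lam1 \<epsilon> Y X = ereal (\<epsilon> / d \<epsilon>)"
    by (simp add: alpha1_def Let_def d_def k_def G_def)
  ultimately show ?thesis
    by (auto simp: divide_le_eq)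
qed

theorem theorem2p2:
  fixes Z :: "real^'n^'p" and D :: "real^'m^'p"
    and lam1 lam2 :: real
    and Y X :: "real^'n^'m"
    and h :: "real^'n^'m \<Rightarrow> real"
  assumes "lam1 \<ge> 0" and "lam2 \<ge> 0"
    and "h = smooth_part Z D lam2"
    and "strongly_convex h"
    and "local_minimizer_on (\<lambda>(Y', X'). h X' + lam1 * real (l0_norm Y'))
           {(Y', X'). Y' = X'} (Y, X)"
  shows "\<exists>U. KKT_point h lam1 Y X U \<and>
           (\<exists>\<epsilon>>0. \<forall>\<alpha>. 0 < \<alpha> \<and>
              ereal \<alpha> < min (alpha1 h lam1 \<epsilon> Y X) (ereal (alpha2 CARD('n) D lam2)) \<longrightarrow>
              P_stationary_point h lam1 \<alpha> Y X U)"
proof -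
  \<comment> \<open>Forced by the gradient equation that both notions share.\<close>
  define U where "U = - gradient h X"
  have YX: "Y = X"
    using assms(5) by (rule local_minimizer_on_diagonal)
  have "GDERIV h X :> gradient h X"
    unfolding assms(3) gradient_smooth_part by (rule GDERIV_smooth_part)
  then have U0: "U $ i $ j = 0" if "lam1 = 0 \<or> Y $ i $ j \<noteq> 0" for i j
    using gradient_entry_eq_0[OF _ local_minimizer_on_diagonal(2)[OF assms(5)]] that
    by (simp add: U_def YX)
  \<comment> \<open>For \<open>lam1 = 0\<close> the quotient is 0 by convention; the identity
    survives because \<open>U0\<close> then gives U = 0.\<close>
  have "0 = lam1 *\<^sub>R (1 / lam1) *\<^sub>R U - U" and "(1 / lam1) *\<^sub>R U \<in> l0_subdiff Y"
    using U0 by (auto simp: l0_subdiff_def vec_eq_iff)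
  then have "0 \<in> (\<lambda>V. lam1 *\<^sub>R V - U) ` l0_subdiff Y"
    by (rule image_eqI)
  then have "KKT_point h lam1 Y X U"
    by (simp add: KKT_point_def YX U_def)
  moreover have "\<exists>\<epsilon>>0. \<forall>\<alpha>. 0 < \<alpha> \<and> ereal \<alpha> < alpha1 h lam1 \<epsilon> Y X
      \<longrightarrow> Y = prox_l0 (\<alpha> * lam1) (Y + \<alpha> *\<^sub>R U)"
  \<comment> \<open>In the first case the denominator of \<open>alpha1\<close> is zero for every
    \<epsilon>, so \<open>alpha1\<close> is infinite and the fixed-point equation has to hold for
    all \<alpha> > 0.\<close>
  proof (cases "lam1 = 0 \<or> (Y = 0 \<and> U = 0)")
    case True
    then have "U = 0"
      using U0 by (auto simp: vec_eq_iff)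
    then have "Y = prox_l0 (\<alpha> * lam1) (Y + \<alpha> *\<^sub>R U)" if "\<alpha> > 0" for \<alpha>
      using True that \<open>lam1 \<ge> 0\<close> by (auto simp: prox_l0_fixed_zero_threshold prox_l0_zero)
    then show ?thesis
      by (intro exI[of _ 1]) simp
  next
    case False
    then have "lam1 > 0" and nz: "Y \<noteq> 0 \<or> gradient h X \<noteq> 0"
      using \<open>lam1 \<ge> 0\<close> by (auto simp: U_def)
    have "\<forall>\<^sub>F \<alpha> in at_right 0. Y = prox_l0 (\<alpha> * lam1) (Y + \<alpha> *\<^sub>R U)"
      by (rule eventually_prox_l0_fixed) (use \<open>lam1 > 0\<close> U0 in auto)
    then obtain \<alpha>\<^sub>0 where "\<alpha>\<^sub>0 > 0"
      and \<alpha>\<^sub>0: "\<And>\<alpha>. 0 < \<alpha> \<Longrightarrow> \<alpha> < \<alpha>\<^sub>0 \<Longrightarrow> Y = prox_l0 (\<alpha> * lam1) (Y + \<alpha> *\<^sub>R U)"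
      by (auto simp: eventually_at_right_field)
    obtain \<epsilon> where "\<epsilon> > 0" and \<epsilon>: "alpha1 h lam1 \<epsilon> Y X \<le> ereal \<alpha>\<^sub>0"
      using alpha1_le_small[OF \<open>lam1 > 0\<close> \<open>\<alpha>\<^sub>0 > 0\<close> nz] by blast
    have "\<alpha> < \<alpha>\<^sub>0" if "ereal \<alpha> < alpha1 h lam1 \<epsilon> Y X" for \<alpha>
      using less_le_trans[OF that \<epsilon>] by simp
    then show ?thesis
      using \<open>\<epsilon> > 0\<close> \<alpha>\<^sub>0 by blast
  qed
  moreover have "P_stationary_point h lam1 \<alpha> Y X U \<longleftrightarrow> Y = prox_l0 (\<alpha> * lam1) (Y + \<alpha> *\<^sub>R U)" for \<alpha>
    using YX by (simp add: P_stationary_point_def U_def)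
  ultimately show ?thesis
    by (metis min_less_iff_conj)
qed

end
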